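(* Let $f\in\mathbb{R}[x_1,\ldots,x_n]$ be a form (homogeneous polynomial) of degree $d$ with $d>2$, and let $\mathbf{x}^*\in\mathbb{S}^{n-1}$ satisfy (FONC). Then $\mathbf{x}^*$ satisfies (SONC) if and only if $$\lambda_1(\nabla^2 f(\mathbf{x}^* ))\,\ge\, d\,f(\mathbf{x}^* )\ \text{ if } f(\mathbf{x}^* )\ge 0,\qquad \lambda_2(\nabla^2 f(\mathbf{x}^* ))\,\ge\, d\,f(\mathbf{x}^* )\ \text{ if } f(\mathbf{x}^* )<0.$$ Moreover, if $f(\mathbf{x}^* )<0$ then $\lambda_1(\nabla^2 f(\mathbf{x}^* ))=d(d-1)f(\mathbf{x}^* )$. If instead $d=2$, then $\mathbf{x}^*$ satisfies (SONC) if and only if $\lambda_1(\nabla^2 f(\mathbf{x}^* ))\ge d\,f(\mathbf{x}^* )$, and there is only one local (hence global) minimum of $f$ on $\mathbb{S}^{n-1}$.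
   Context: $\mathbb{S}^{n-1}$ is the Euclidean unit sphere in $\mathbb{R}^n$. For $\mathbf{x}\in\mathbb{S}^{n-1}$, $\mathbf{x}^\perp:=\{\mathbf{u}\in\mathbb{S}^{n-1}:\mathbf{u}^T\mathbf{x}=0\}$ (unit vectors orthogonal to $\mathbf{x}$). For a real symmetric matrix $A$, $\lambda_1(A)\le\lambda_2(A)\le\cdots\le\lambda_n(A)$ are its eigenvalues arranged in increasing order. $\nabla f$ and $\nabla^2 f$ are the gradient and Hessian of $f$. A point $\mathbf{x}^*\in\mathbb{S}^{n-1}$ satisfies (FONC) if there is $\lambda^*\in\mathbb{R}$ with $\nabla f(\mathbf{x}^* )+2\lambda^*\mathbf{x}^*=0$. A point $\mathbf{x}^*$ satisfying (FONC), with this $\lambda^*$, satisfies (SONC) if $\mathbf{u}^T\nabla^2 f(\mathbf{x}^* )\mathbf{u}+2\lambda^*\ge 0$ for all $\mathbf{u}\in(\mathbf{x}^* )^\perp$. A local minimizer of $f$ on $\mathbb{S}^{n-1}$ is a point $\mathbf{x}^*\in\mathbb{S}^{n-1}$ such that for some $\varepsilon>0$, $f(\mathbf{x}^* )\le f(\mathbf{x})$ for all $\mathbf{x}\in\mathbb{S}^{n-1}$ with $\|\mathbf{x}-\mathbf{x}^*\|<\varepsilon$; the value $f(\mathbf{x}^* )$ is then called a local minimum.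
   Formalization: The "Moreover" formula for λ₁ is proved for x* satisfying (SONC); under (FONC) alone it fails, e.g. f = -x³ - 10xy² at (1,0), where λ₁ = -20 but d(d-1)f = -6. For n = 1, where λ₂ does not exist, the λ₂ condition is read as empty. *)

theory Defs
  imports
    "HOL-Analysis.Analysis"
    "HOL-Computational_Algebra.Polynomial"
    "HOL-Library.Poly_Mapping"
begin

text \<open>
  A polynomial over the reals in variables indexed by a finite type \<open>'n\<close>: a finitely supported map
  from monomials (exponent vectors) to coefficients.
\<close>

type_synonym 'n real_mpoly = "('n \<Rightarrow>\<^sub>0 nat) \<Rightarrow>\<^sub>0 real"

definition peval :: "'n::finite real_mpoly \<Rightarrow> real^'n \<Rightarrow> real" where
  "peval p x = (\<Sum>m\<in>Poly_Mapping.keys p.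
     Poly_Mapping.lookup p m * (\<Prod>i\<in>UNIV. (x $ i) ^ Poly_Mapping.lookup m i))"

text \<open>The zero polynomial counts as a form of every degree.\<close>

definition is_form :: "nat \<Rightarrow> 'n::finite real_mpoly \<Rightarrow> bool" where
  "is_form d p \<longleftrightarrow>
     (\<forall>m\<in>Poly_Mapping.keys p. (\<Sum>i\<in>UNIV. Poly_Mapping.lookup m i) = d)"

definition gradient :: "(real^'n \<Rightarrow> real) \<Rightarrow> real^'n::finite \<Rightarrow> real^'n" where
  "gradient f x = (\<chi> i. frechet_derivative f (at x) (axis i 1))"

definition hessian :: "(real^'n \<Rightarrow> real) \<Rightarrow> real^'n::finite \<Rightarrow> real^'n^'n" where
  "hessian f x = jacobian (gradient f) (at x)"

definition charpoly :: "real^'n^'n::finite \<Rightarrow> real poly" where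
  "charpoly A = det (mat [:0, 1:] - map_matrix (\<lambda>a. [:a:]) A)"

text \<open>
  The \<open>k\<close>-th smallest real eigenvalue, counted from 1 and with multiplicity. A real symmetric
  matrix of size \<open>n\<close> has \<open>n\<close> of them, so the value is meaningful for \<open>1 \<le> k \<le> n\<close>.
\<close>

definition eigval :: "nat \<Rightarrow> real^'n^'n::finite \<Rightarrow> real" where
  "eigval k A = sorted_list_of_multiset (proots (charpoly A)) ! (k - 1)"

definition unit_perp :: "real^'n \<Rightarrow> (real^'n::finite) set" where
  "unit_perp x = {u \<in> sphere 0 1. u \<bullet> x = 0}"

definition FONC_with :: "(real^'n \<Rightarrow> real) \<Rightarrow> real^'n::finite \<Rightarrow> real \<Rightarrow> bool" where
  "FONC_with f x l \<longleftrightarrow> x \<in> sphere 0 1 \<and> gradient f x + (2 * l) *\<^sub>R x = 0"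

definition FONC :: "(real^'n \<Rightarrow> real) \<Rightarrow> real^'n::finite \<Rightarrow> bool" where
  "FONC f x \<longleftrightarrow> (\<exists>l. FONC_with f x l)"

text \<open>The multiplier \<open>l\<close> is unique, because \<open>x \<noteq> 0\<close> on the sphere.\<close>

definition SONC :: "(real^'n \<Rightarrow> real) \<Rightarrow> real^'n::finite \<Rightarrow> bool" where
  "SONC f x \<longleftrightarrow>
     (\<exists>l. FONC_with f x l \<and> (\<forall>u\<in>unit_perp x. u \<bullet> (hessian f x *v u) + 2 * l \<ge> 0))"

definition local_minimizer :: "(real^'n \<Rightarrow> real) \<Rightarrow> real^'n::finite \<Rightarrow> bool" where
  "local_minimizer f x \<longleftrightarrow> x \<in> sphere 0 1 \<and>
     (\<exists>\<epsilon>>0. \<forall>y\<in>sphere 0 1. norm (y - x) < \<epsilon> \<longrightarrow> f x \<le> f y)"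

definition local_minimum :: "(real^'n::finite \<Rightarrow> real) \<Rightarrow> real \<Rightarrow> bool" where
  "local_minimum f v \<longleftrightarrow> (\<exists>x. local_minimizer f x \<and> f x = v)"

definition global_minimum :: "(real^'n::finite \<Rightarrow> real) \<Rightarrow> real \<Rightarrow> bool" where
  "global_minimum f v \<longleftrightarrow> (\<exists>x\<in>sphere 0 1. f x = v \<and> (\<forall>y\<in>sphere 0 1. v \<le> f y))"

end

theory Submission
  imports Defs
begin

text \<open>
  Write \<open>H\<close> for the Hessian of \<open>f\<close> at a point \<open>x\<close> of the sphere that satisfies (FONC). Euler's
  identity for homogeneous functions, applied to \<open>f\<close>, evaluates the multiplier:
  \<open>-2\<lambda> = x \<bullet> \<nabla>f(x) = d f(x)\<close>. Applied to the gradient, which is homogeneous of degree \<open>d - 1\<close>, it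
  gives \<open>H x = (d - 1) \<nabla>f(x) = d (d - 1) f(x) x\<close>. So \<open>x\<close> is itself an eigenvector of \<open>H\<close>.

  The symmetric matrix \<open>H\<close> therefore has an orthonormal eigenbasis that contains \<open>x\<close>, and (SONC)
  says that every eigenvalue other than the one at \<open>x\<close> is at least \<open>d f(x)\<close>
  (\<open>homogeneous_FONC_hessian_spectrum\<close>). What is left is to compare the eigenvalue at \<open>x\<close>
  with \<open>d f(x)\<close>. If \<open>f(x) \<ge> 0\<close>, or if \<open>d = 2\<close>, it is at least \<open>d f(x)\<close>, so (SONC) amounts to a
  bound on all eigenvalues. If \<open>f(x) < 0\<close> and \<open>d > 2\<close>, it lies strictly below \<open>d f(x)\<close>, so (SONC)
  says that it is the only such eigenvalue, which is a bound on the second smallest one; the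
  eigenvalue at \<open>x\<close> is then the smallest. Both bounds are read off the characteristic polynomial by
  counting: \<open>\<lambda>\<^sub>k \<ge> c\<close> iff fewer than \<open>k\<close> eigenvalues lie below \<open>c\<close> (\<open>eigval_ge_iff\<close>).

  For \<open>d = 2\<close> the parallelogram law \<open>f(x + sv) + f(x - sv) = 2 f(x) + 2 s\<^sup>2 f(v)\<close> transports the
  inequality \<open>f(z) \<ge> f(x) |z|\<^sup>2\<close>, valid near a local minimizer \<open>x\<close>, to every direction \<open>v\<close>. Hence
  local minimizers are global ones, and compactness of the sphere provides one.
\<close>

section \<open>Orthonormal eigenbases of symmetric matrices\<close>

lemma matrix_vector_mult_inner:
  fixes M :: "real^'n::finite^'m::finite"
  shows "(M *v u) \<bullet> w = u \<bullet> (transpose M *v w)"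
  by (metis dot_lmul_matrix vector_transpose_matrix)

lemma symmetric_matrix_inner:
  fixes A :: "real^'n^'n::finite"
  assumes "transpose A = A"
  shows "(A *v u) \<bullet> w = u \<bullet> (A *v w)"
  by (simp add: matrix_vector_mult_inner assms)

text \<open>
  A minimizer \<open>v\<close> of the Rayleigh quotient on the unit sphere of \<open>S\<close> is an eigenvector: with the
  minimum \<open>\<mu>\<close>, the form \<open>u \<bullet> A u - \<mu> |u|\<^sup>2\<close> is nonnegative on \<open>S\<close> and vanishes at \<open>v\<close>, so its derivative
  at \<open>v\<close> in the direction of the residual \<open>r = A v - \<mu> v \<in> S\<close>, which is \<open>2 |r|\<^sup>2\<close>, must be zero.
\<close>
lemma symmetric_matrix_eigenvector_in_invariant_subspace:
  fixes A :: "real^'n^'n::finite"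
  assumes sym: "transpose A = A" and S: "subspace S" and inv: "\<And>v. v \<in> S \<Longrightarrow> A *v v \<in> S"
    and nz: "w \<in> S" "w \<noteq> 0"
  shows "\<exists>v\<in>S. norm v = 1 \<and> (\<exists>\<mu>. A *v v = \<mu> *\<^sub>R v)"
proof -
  let ?q = "\<lambda>v. v \<bullet> (A *v v)"
  have "compact (sphere 0 1 \<inter> S)"
    by (intro compact_Int_closed compact_sphere closed_subspace S)
  moreover have "w /\<^sub>R norm w \<in> sphere 0 1 \<inter> S"
    using nz S by (simp add: subspace_scale)
  then have "sphere 0 1 \<inter> S \<noteq> {}" by blast
  moreover have "continuous_on (sphere 0 1 \<inter> S) ?q"
    by (intro continuous_intros matrix_vector_mult_linear_continuous_on)
  ultimately have "\<exists>v\<in>sphere 0 1 \<inter> S. \<forall>u\<in>sphere 0 1 \<inter> S. ?q v \<le> ?q u"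
    by (rule continuous_attains_inf)
  then obtain v where v: "norm v = 1" "v \<in> S"
    and min: "\<And>u. norm u = 1 \<Longrightarrow> u \<in> S \<Longrightarrow> ?q v \<le> ?q u"
    by auto
  define \<mu> where "\<mu> = ?q v"
  have nonneg: "\<mu> * (u \<bullet> u) \<le> ?q u" if "u \<in> S" for u
  proof (cases "u = 0")
    case False
    then have "\<mu> \<le> ?q (u /\<^sub>R norm u)"
      unfolding \<mu>_def using that S by (intro min) (auto simp: subspace_scale)
    also have "\<dots> = ?q u / (u \<bullet> u)"
      by (simp add: matrix_vector_mult_scaleR dot_square_norm power2_eq_square field_simps)
    finally show ?thesis using False by (simp add: field_simps)
  qed simp
  define r where "r = A *v v - \<mu> *\<^sub>R v"
  have "r \<in> S" unfolding r_def using v S inv by (simp add: subspace_diff subspace_scale)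
  have expand: "0 \<le> t * (2 * (r \<bullet> r)) + t\<^sup>2 * (?q r - \<mu> * (r \<bullet> r))" for t
  proof -
    have "0 \<le> ?q (v + t *\<^sub>R r) - \<mu> * ((v + t *\<^sub>R r) \<bullet> (v + t *\<^sub>R r))"
      using nonneg[of "v + t *\<^sub>R r"] v S \<open>r \<in> S\<close> by (simp add: subspace_add subspace_scale)
    also have "\<dots> = t * (2 * (r \<bullet> (A *v v) - \<mu> * (r \<bullet> v))) + t\<^sup>2 * (?q r - \<mu> * (r \<bullet> r))"
      using v(1) symmetric_matrix_inner[OF sym, of v r] inner_commute[of "A *v v" r]
        inner_commute[of v r] dot_square_norm[of v]
      by (simp add: matrix_vector_right_distrib matrix_vector_mult_scaleR inner_simps
          \<mu>_def[symmetric] power2_eq_square algebra_simps)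
    also have "r \<bullet> (A *v v) - \<mu> * (r \<bullet> v) = r \<bullet> r" by (simp add: r_def inner_simps)
    finally show ?thesis .
  qed
  have "r = 0"
  proof (rule ccontr)
    assume "r \<noteq> 0"
    then have pos: "r \<bullet> r > 0" by simp
    \<comment> \<open>A bound on the quadratic coefficient; the step \<open>t\<close> minimizes \<open>2 |r|\<^sup>2 t + K t\<^sup>2\<close>.\<close>
    define K where "K = \<bar>?q r - \<mu> * (r \<bullet> r)\<bar> + 1"
    have K: "K > 0" "?q r - \<mu> * (r \<bullet> r) \<le> K" by (auto simp: K_def)
    define t where "t = - (r \<bullet> r) / K"
    have "t\<^sup>2 * (?q r - \<mu> * (r \<bullet> r)) \<le> t\<^sup>2 * K" using K by (intro mult_left_mono) auto
    then have "0 \<le> t * (2 * (r \<bullet> r)) + t\<^sup>2 * K" using expand[of t] by linarith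
    also have "\<dots> = - ((r \<bullet> r)\<^sup>2 / K)" using K by (simp add: t_def field_simps power2_eq_square)
    finally show False using pos K by (simp add: divide_le_0_iff)
  qed
  then show ?thesis using v by (auto simp: r_def)
qed

text \<open>
  Take an orthonormal set of eigenvectors through \<open>x\<close> of maximal size. The orthogonal complement of
  its span is invariant under the symmetric \<open>A\<close>; if it were nonzero, it would contain another
  eigenvector and the set could be enlarged.
\<close>
lemma symmetric_matrix_orthonormal_eigenbasis_extending:
  fixes A :: "real^'n^'n::finite"
  assumes sym: "transpose A = A" and x: "norm x = 1" "A *v x = \<mu> *\<^sub>R x"
  obtains B where "x \<in> B" "card B = CARD('n)" "pairwise orthogonal B"
    "\<And>b. b \<in> B \<Longrightarrow> norm b = 1" "\<And>b. b \<in> B \<Longrightarrow> \<exists>\<mu>. A *v b = \<mu> *\<^sub>R b"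
proof -
  define good where "good B \<longleftrightarrow> x \<in> B \<and> pairwise orthogonal B \<and>
      (\<forall>b\<in>B. norm b = 1 \<and> (\<exists>\<mu>. A *v b = \<mu> *\<^sub>R b))" for B
  have ind: "independent B" if "good B" for B
    using that by (intro pairwise_orthogonal_independent) (auto simp: good_def)
  have bound: "finite B" "card B \<le> CARD('n)" if "good B" for B
    using independent_bound[OF ind[OF that]] by auto
  have "good {x}" using x by (auto simp: good_def)
  then have "\<exists>B. good B \<and> (\<forall>C. good C \<longrightarrow> card C \<le> card B)"
    by (rule ex_has_greatest_nat[where b = "Suc CARD('n)"]) (simp add: bound(2) less_Suc_eq_le)
  then obtain B where B: "good B" and max: "\<And>C. good C \<Longrightarrow> card C \<le> card B"
    by blast
  have "card B = CARD('n)"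
  proof (rule ccontr)
    assume "card B \<noteq> CARD('n)"
    then have "dim B < DIM(real^'n)"
      using bound(2)[OF B] dim_eq_card_independent[OF ind[OF B]] by simp
    from orthogonal_to_subspace_exists[OF this]
    obtain w where w: "w \<noteq> 0" "\<And>b. b \<in> span B \<Longrightarrow> orthogonal w b"
      by metis
    define S where "S = {v. \<forall>b\<in>B. b \<bullet> v = 0}"
    have "subspace S" by (auto simp: S_def subspace_def inner_simps)
    moreover have "A *v v \<in> S" if "v \<in> S" for v
    proof -
      have "b \<bullet> (A *v v) = 0" if b: "b \<in> B" for b
      proof -
        obtain \<nu> where "A *v b = \<nu> *\<^sub>R b" using B b unfolding good_def by blast
        then show ?thesis
          using symmetric_matrix_inner[OF sym, of b v] \<open>v \<in> S\<close> b by (auto simp: S_def)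
      qed
      then show ?thesis by (simp add: S_def)
    qed
    moreover have "w \<in> S"
      using w(2) by (auto simp: S_def orthogonal_def inner_commute span_base)
    ultimately obtain v \<nu> where v: "v \<in> S" "norm v = 1" "A *v v = \<nu> *\<^sub>R v"
      using symmetric_matrix_eigenvector_in_invariant_subspace[OF sym, of S w] w(1) by blast
    have "v \<notin> B" using v by (auto simp: S_def)
    moreover have "good (insert v B)"
      using B v by (auto simp: good_def S_def pairwise_insert orthogonal_def inner_commute)
    ultimately show False using max[of "insert v B"] bound(1)[OF B] by simp
  qed
  then show thesis using B by (intro that[of B]) (simp_all add: good_def)
qed

definition diagonal_matrix :: "('n \<Rightarrow> 'a::zero) \<Rightarrow> 'a^'n^'n::finite" where
  "diagonal_matrix l = (\<chi> i j. if i = j then l i else 0)"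

text \<open>
  The rows of \<open>P\<close> are the eigenvectors. That the given \<open>x\<close> can be prescribed as one of them is what
  later separates the eigenvalue at \<open>x\<close> from those on the orthogonal complement of \<open>x\<close>.
\<close>
lemma symmetric_matrix_diagonalization_extending:
  fixes A :: "real^'n^'n::finite"
  assumes sym: "transpose A = A" and x: "norm x = 1" "A *v x = \<mu> *\<^sub>R x"
  obtains P l i\<^sub>0 where "orthogonal_matrix P" "A = transpose P ** diagonal_matrix l ** P"
    "P $ i\<^sub>0 = x" "l i\<^sub>0 = \<mu>"
proof -
  obtain B where B: "x \<in> B" "card B = CARD('n)" "pairwise orthogonal B"
    "\<And>b. b \<in> B \<Longrightarrow> norm b = 1" "\<And>b. b \<in> B \<Longrightarrow> \<exists>\<mu>. A *v b = \<mu> *\<^sub>R b"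
    using symmetric_matrix_orthonormal_eigenbasis_extending[OF assms] by blast
  have "finite B" using B(2) by (metis card.infinite zero_less_card_finite less_irrefl)
  then obtain b where b: "bij_betw b (UNIV :: 'n set) B"
    using B(2) by (metis finite_same_card_bij finite)
  have bB: "b i \<in> B" for i using b by (auto simp: bij_betw_def)
  obtain l where l: "\<And>i. A *v b i = l i *\<^sub>R b i" using B(5)[OF bB] by metis
  obtain i\<^sub>0 where i0: "b i\<^sub>0 = x" using b B(1) by (metis bij_betw_imp_surj_on imageE)
  have ortho: "b i \<bullet> b j = (if i = j then 1 else 0)" for i j
  proof (cases "i = j")
    case True
    then show ?thesis using B(4)[OF bB[of i]] by (simp add: dot_square_norm)
  next
    case False
    then have "b i \<noteq> b j" using b by (auto simp: bij_betw_def inj_on_def)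
    then show ?thesis using B(3) bB False by (auto simp: pairwise_def orthogonal_def)
  qed
  define P where "P = (\<chi> i. b i)"
  have "P ** transpose P = mat 1"
    using ortho by (simp add: vec_eq_iff P_def matrix_mult_dot mat_def inner_vec_def matrix_matrix_mult_def transpose_def)
  then have P: "orthogonal_matrix P"
    using matrix_left_right_inverse orthogonal_matrix by blast
  have "(P ** A) $ i = (diagonal_matrix l ** P) $ i" for i
  proof -
    have "(P ** A) $ i = A *v b i"
      by (subst (2) sym[symmetric])
        (simp add: vec_eq_iff P_def matrix_matrix_mult_def matrix_vector_mult_def transpose_def mult.commute)
    moreover have "(diagonal_matrix l ** P) $ i = l i *\<^sub>R b i"
      by (simp add: vec_eq_iff P_def matrix_matrix_mult_def diagonal_matrix_def if_distrib[of "\<lambda>u. u * _"] cong: if_cong)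
    ultimately show ?thesis using l by simp
  qed
  then have "P ** A = diagonal_matrix l ** P" by (simp add: vec_eq_iff)
  then have "transpose P ** diagonal_matrix l ** P = transpose P ** P ** A"
    by (simp add: matrix_mul_assoc[symmetric])
  also have "\<dots> = A" using P by (simp add: orthogonal_matrix_def)
  finally have "A = transpose P ** diagonal_matrix l ** P" ..
  moreover have "P $ i\<^sub>0 = x" by (simp add: P_def i0)
  moreover have "l i\<^sub>0 = \<mu>"
    using l[of i\<^sub>0] x by (metis i0 norm_zero scaleR_cancel_right zero_neq_one)
  ultimately show thesis using that P by blast
qed

lemma quadratic_form_diagonalized:
  fixes P :: "real^'n^'n::finite"
  shows "u \<bullet> ((transpose P ** diagonal_matrix l ** P) *v u) = (\<Sum>i\<in>UNIV. l i * ((P *v u) $ i)\<^sup>2)"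
proof -
  have "u \<bullet> ((transpose P ** diagonal_matrix l ** P) *v u)
      = (P *v u) \<bullet> (diagonal_matrix l *v (P *v u))"
    by (simp add: matrix_vector_mult_inner flip: matrix_vector_mul_assoc)
  then show ?thesis
    by (simp add: inner_vec_def matrix_vector_mult_def diagonal_matrix_def power2_eq_square
        if_distrib[of "\<lambda>u. u * _"] algebra_simps cong: if_cong)
qed

text \<open>
  In the coordinates \<open>y = P u\<close> the form is \<open>\<Sum>i. l i y\<^sub>i\<^sup>2\<close>, and orthogonality to the row \<open>i\<^sub>0\<close> means
  that the coordinate \<open>i\<^sub>0\<close> vanishes. The form takes the value \<open>l i\<close> at the row \<open>i\<close>, so
  every remaining eigenvalue has to satisfy the bound.
\<close>
lemma quadratic_form_ge_on_unit_perp_iff: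
  fixes P :: "real^'n^'n::finite"
  assumes P: "orthogonal_matrix P"
  shows "(\<forall>u\<in>unit_perp (P $ i\<^sub>0). c \<le> u \<bullet> ((transpose P ** diagonal_matrix l ** P) *v u))
     \<longleftrightarrow> (\<forall>i. i \<noteq> i\<^sub>0 \<longrightarrow> c \<le> l i)"
proof (intro iffI ballI allI impI)
  have ortho: "P $ i \<bullet> P $ j = (if i = j then 1 else 0)" for i j
  proof -
    have "(P ** transpose P) $ i $ j = mat 1 $ i $ j"
      using P by (simp add: orthogonal_matrix_def)
    then show ?thesis
      by (simp add: matrix_matrix_mult_def transpose_def inner_vec_def mat_def)
  qed
  {
    fix i
    assume ge: "\<forall>u\<in>unit_perp (P $ i\<^sub>0). c \<le> u \<bullet> ((transpose P ** diagonal_matrix l ** P) *v u)"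
      and "i \<noteq> i\<^sub>0"
    then have "P $ i \<in> unit_perp (P $ i\<^sub>0)"
      using ortho by (auto simp: unit_perp_def norm_eq_sqrt_inner)
    with ge have "c \<le> (\<Sum>j\<in>UNIV. l j * ((P *v (P $ i)) $ j)\<^sup>2)"
      by (simp only: quadratic_form_diagonalized[symmetric])
    also have "\<dots> = l i"
      by (simp add: matrix_vector_mul_component ortho if_distrib[of "\<lambda>u. u\<^sup>2"]
          if_distrib[of "\<lambda>u. _ * u"] cong: if_cong)
    finally show "c \<le> l i" .
  }
  fix u assume l: "\<forall>i. i \<noteq> i\<^sub>0 \<longrightarrow> c \<le> l i" and "u \<in> unit_perp (P $ i\<^sub>0)"
  then have u: "norm u = 1" "(P *v u) $ i\<^sub>0 = 0"
    by (auto simp: unit_perp_def matrix_vector_mul_component inner_commute)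
  have "norm (P *v u) = norm u"
  proof -
    have "(P *v u) \<bullet> (P *v u) = u \<bullet> ((transpose P ** P) *v u)"
      by (simp add: matrix_vector_mult_inner flip: matrix_vector_mul_assoc)
    then show ?thesis using P by (simp add: norm_eq_sqrt_inner orthogonal_matrix_def)
  qed
  then have "c = c * (\<Sum>i\<in>UNIV. ((P *v u) $ i)\<^sup>2)"
    using u(1) dot_square_norm[of "P *v u"] by (simp add: inner_vec_def power2_eq_square)
  also have "\<dots> \<le> (\<Sum>i\<in>UNIV. l i * ((P *v u) $ i)\<^sup>2)"
    unfolding sum_distrib_left
  proof (rule sum_mono)
    fix i show "c * ((P *v u) $ i)\<^sup>2 \<le> l i * ((P *v u) $ i)\<^sup>2"
      using l u(2) by (cases "i = i\<^sub>0") (auto intro: mult_right_mono)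
  qed
  finally show "c \<le> u \<bullet> ((transpose P ** diagonal_matrix l ** P) *v u)"
    by (simp only: quadratic_form_diagonalized)
qed

section \<open>Eigenvalues as sorted roots of the characteristic polynomial\<close>

lemma map_matrix_pCons_mult:
  fixes A B :: "'a::comm_ring_1^'n^'n::finite"
  shows "map_matrix (\<lambda>a. [:a:]) (A ** B) = map_matrix (\<lambda>a. [:a:]) A ** map_matrix (\<lambda>a. [:a:]) B"
proof -
  have "[:\<Sum>i\<in>S. g i:] = (\<Sum>i\<in>S. [:g i:])" for S :: "'n set" and g :: "'n \<Rightarrow> 'a"
    by (rule poly_eqI) (simp add: coeff_sum coeff_pCons sum.If_cases split: nat.splits)
  then show ?thesis by (simp add: vec_eq_iff matrix_matrix_mult_def mult.commute)
qed

lemma matrix_mult_diff_distrib: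
  fixes A :: "'a::ring_1^'n::finite^'n"
  shows "A ** (B - C) = A ** B - A ** C" "(D - E) ** A = D ** A - E ** A"
  by (simp_all add: vec_eq_iff matrix_matrix_mult_def algebra_simps sum_subtractf)

text \<open>
  Conjugation by an orthogonal matrix does not change a determinant, also over the polynomial ring,
  and scalar matrices such as \<open>X I\<close> commute with everything.
\<close>
lemma charpoly_diagonalized:
  fixes P :: "real^'n^'n::finite"
  assumes P: "orthogonal_matrix P"
  shows "charpoly (transpose P ** diagonal_matrix l ** P) = (\<Prod>i\<in>UNIV. [:- l i, 1:])"
proof -
  let ?C = "map_matrix (\<lambda>a::real. [:a:]) :: real^'n^'n \<Rightarrow> real poly^'n^'n"
  let ?X = "mat [:0, 1:] :: real poly^'n^'n"
  have one: "?C (transpose P) ** ?C P = mat 1"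
    using P by (simp add: orthogonal_matrix_def vec_eq_iff mat_def flip: map_matrix_pCons_mult)
  have "M ** ?X = ?X ** M" for M
    by (simp add: vec_eq_iff matrix_matrix_mult_def mat_def if_distrib[of "\<lambda>u. u * _"]
        if_distrib[of "\<lambda>u. _ * u"] mult.commute cong: if_cong)
  then have "?C (transpose P) ** ?X ** ?C P = ?X ** (?C (transpose P) ** ?C P)"
    by (simp add: matrix_mul_assoc)
  then have "?X - ?C (transpose P ** diagonal_matrix l ** P)
      = ?C (transpose P) ** (?X - ?C (diagonal_matrix l)) ** ?C P"
    by (simp add: one map_matrix_pCons_mult matrix_mult_diff_distrib)
  then have "charpoly (transpose P ** diagonal_matrix l ** P)
      = det (?C (transpose P) ** ?C P) * det (?X - ?C (diagonal_matrix l))"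
    unfolding charpoly_def by (simp add: det_mul mult_ac)
  also have "\<dots> = det (?X - ?C (diagonal_matrix l))" by (simp add: one)
  also have "\<dots> = (\<Prod>i\<in>UNIV. (?X - ?C (diagonal_matrix l)) $ i $ i)"
    by (rule det_diagonal) (simp add: mat_def diagonal_matrix_def)
  also have "\<dots> = (\<Prod>i\<in>UNIV. [:- l i, 1:])"
    by (simp add: mat_def diagonal_matrix_def)
  finally show ?thesis .
qed

lemma sorted_nth_ge_iff:
  fixes xs :: "'a::linorder list"
  assumes "sorted xs" "k < length xs"
  shows "c \<le> xs ! k \<longleftrightarrow> length (filter (\<lambda>y. y < c) xs) \<le> k"
  using assms
proof (induction xs arbitrary: k)
  case (Cons a xs)
  show ?case
  proof (cases "a < c")
    case True
    then show ?thesis using Cons by (cases k) auto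
  next
    case False
    with Cons.prems have "\<forall>y\<in>set (a # xs). c \<le> y" by auto
    moreover from this have "filter (\<lambda>y. y < c) (a # xs) = []" by (auto simp: filter_empty_conv not_less)
    ultimately show ?thesis using Cons.prems(2) nth_mem by (metis le0 list.size(3))
  qed
qed simp

text \<open>
  Lower bounds on the \<open>k\<close>-th smallest eigenvalue determine it, and in this form they refer only to
  the family \<open>l\<close> and not to an ordering of it.
\<close>
lemma eigval_ge_iff:
  fixes P :: "real^'n^'n::finite"
  assumes P: "orthogonal_matrix P" and A: "A = transpose P ** diagonal_matrix l ** P"
    and k: "1 \<le> k" "k \<le> CARD('n)"
  shows "c \<le> eigval k A \<longleftrightarrow> card {i. l i < c} < k"
proof -
  have "proots (charpoly A) = (\<Sum>i\<in>UNIV. {#l i#})"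
    unfolding A charpoly_diagonalized[OF P] by (subst proots_prod) auto
  also have "\<dots> = image_mset l (mset_set UNIV)" by (simp add: sum_unfold_sum_mset)
  finally have roots: "proots (charpoly A) = image_mset l (mset_set UNIV)" .
  let ?xs = "sorted_list_of_multiset (proots (charpoly A))"
  have "length ?xs = CARD('n)"
    by (metis mset_sorted_list_of_multiset roots size_image_mset size_mset size_mset_set)
  then have "c \<le> ?xs ! (k - 1) \<longleftrightarrow> length (filter (\<lambda>y. y < c) ?xs) \<le> k - 1"
    using k by (intro sorted_nth_ge_iff) auto
  also have "length (filter (\<lambda>y. y < c) ?xs) = size (filter_mset (\<lambda>y. y < c) (mset ?xs))"
    by (metis mset_filter size_mset)
  also have "\<dots> = card {i. l i < c}"
    by (simp add: roots filter_mset_image_mset)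
  finally show ?thesis using k unfolding eigval_def by auto
qed


section \<open>Derivatives of polynomials and Euler's identity\<close>

lemma real_polynomial_function_peval: "real_polynomial_function (peval p)"
  unfolding peval_def
  by (intro real_polynomial_function_sum real_polynomial_function.intros(2,4) real_polynomial_function_prod real_polynomial_function_power
      real_polynomial_function.intros(1) bounded_linear_vec_nth) (auto simp: Poly_Mapping.finite_keys)

text \<open>
  Existence of two derivatives and symmetry of the second one are carried through the same
  induction. Only products need a computation: the second derivative of \<open>f g\<close> is
  \<open>f H\<^sub>g + g H\<^sub>f\<close> plus the symmetric cross terms in the two gradients.
\<close>
lemma real_polynomial_function_twice_differentiable:
  fixes f :: "'a::euclidean_space \<Rightarrow> real"
  assumes "real_polynomial_function f"
  shows "\<exists>G H. (\<forall>x. (f has_derivative (\<lambda>h. G x \<bullet> h)) (at x)) \<and>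
               (\<forall>x. (G has_derivative H x) (at x)) \<and>
               (\<forall>x h k. H x h \<bullet> k = h \<bullet> H x k)"
  using assms
proof induction
  case (linear f)
  then obtain a where a: "f = (\<lambda>x. a \<bullet> x)"
    using that[of "adjoint f 1"] adjoint_works[OF bounded_linear.linear[OF linear], of _ 1]
    by (auto simp: fun_eq_iff inner_commute)
  show ?case
    unfolding a
    by (rule exI[of _ "\<lambda>x. a"], rule exI[of _ "\<lambda>x h. 0"]) (auto intro!: derivative_eq_intros)
next
  case (const c)
  show ?case
    by (rule exI[of _ "\<lambda>x. 0"], rule exI[of _ "\<lambda>x h. 0"]) (auto intro!: derivative_eq_intros)
next
  case (add f g)
  then obtain G1 H1 G2 H2 where *:
    "\<And>x. (f has_derivative (\<lambda>h. G1 x \<bullet> h)) (at x)" "\<And>x. (G1 has_derivative H1 x) (at x)"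
    "\<And>x h k. H1 x h \<bullet> k = h \<bullet> H1 x k"
    "\<And>x. (g has_derivative (\<lambda>h. G2 x \<bullet> h)) (at x)" "\<And>x. (G2 has_derivative H2 x) (at x)"
    "\<And>x h k. H2 x h \<bullet> k = h \<bullet> H2 x k"
    by metis
  show ?case
    by (rule exI[of _ "\<lambda>x. G1 x + G2 x"], rule exI[of _ "\<lambda>x h. H1 x h + H2 x h"])
      (use * in \<open>auto intro!: derivative_eq_intros simp: inner_simps\<close>)
next
  case (mult f g)
  then obtain G1 H1 G2 H2 where *:
    "\<And>x. (f has_derivative (\<lambda>h. G1 x \<bullet> h)) (at x)" "\<And>x. (G1 has_derivative H1 x) (at x)"
    "\<And>x h k. H1 x h \<bullet> k = h \<bullet> H1 x k"
    "\<And>x. (g has_derivative (\<lambda>h. G2 x \<bullet> h)) (at x)" "\<And>x. (G2 has_derivative H2 x) (at x)"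
    "\<And>x h k. H2 x h \<bullet> k = h \<bullet> H2 x k"
    by metis
  let ?G = "\<lambda>x. f x *\<^sub>R G2 x + g x *\<^sub>R G1 x"
  let ?H = "\<lambda>x h. f x *\<^sub>R H2 x h + (G1 x \<bullet> h) *\<^sub>R G2 x + (g x *\<^sub>R H1 x h + (G2 x \<bullet> h) *\<^sub>R G1 x)"
  have "((\<lambda>x. f x * g x) has_derivative (\<lambda>h. ?G x \<bullet> h)) (at x)" for x
    by (rule derivative_eq_intros *)+ (auto simp: inner_simps)
  moreover have "(?G has_derivative ?H x) (at x)" for x
    by (intro has_derivative_add has_derivative_scaleR *)
  moreover have "?H x h \<bullet> k = h \<bullet> ?H x k" for x h k
    using *(3,6) by (simp add: inner_simps inner_commute)
  ultimately show ?case by (intro exI[of _ ?G] exI[of _ ?H]) simp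
qed

lemma real_polynomial_function_derivatives:
  fixes f :: "real^'n::finite \<Rightarrow> real"
  assumes "real_polynomial_function f"
  shows has_derivative_gradient: "(f has_derivative (\<lambda>h. gradient f x \<bullet> h)) (at x)"
    and has_derivative_hessian: "(gradient f has_derivative (\<lambda>h. hessian f x *v h)) (at x)"
    and transpose_hessian: "transpose (hessian f x) = hessian f x"
proof -
  obtain G H where G: "\<And>x. (f has_derivative (\<lambda>h. G x \<bullet> h)) (at x)"
    and H: "\<And>x. (G has_derivative H x) (at x)" and sym: "\<And>x h k. H x h \<bullet> k = h \<bullet> H x k"
    using real_polynomial_function_twice_differentiable[OF assms] by metis
  have grad: "gradient f = G"
    using frechet_derivative_at[OF G]
    by (auto simp: fun_eq_iff gradient_def vec_eq_iff inner_axis simp flip: frechet_derivative_at[OF G])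
  show "(f has_derivative (\<lambda>h. gradient f x \<bullet> h)) (at x)"
    using G by (simp add: grad)
  have hess: "hessian f x *v h = H x h" for x h
  proof -
    have "(G has_derivative (\<lambda>h. hessian f x *v h)) (at x)"
      unfolding hessian_def grad jacobian_works[symmetric] differentiable_def using H by blast
    from has_derivative_unique[OF this H] show ?thesis by (rule fun_cong)
  qed
  then show "(gradient f has_derivative (\<lambda>h. hessian f x *v h)) (at x)"
    using H by (simp add: grad)
  have "(transpose (hessian f x) *v h) \<bullet> k = (hessian f x *v h) \<bullet> k" for h k
    using sym[of x h k] by (simp add: hess transpose_matrix_vector dot_lmul_matrix)
  then have "transpose (hessian f x) *v h = hessian f x *v h" for h
    using vector_eq_rdot by blast
  then show "transpose (hessian f x) = hessian f x"
    by (simp add: matrix_eq)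
qed

lemma peval_homogeneous:
  assumes "is_form d p"
  shows "peval p (t *\<^sub>R x) = t ^ d * peval p x"
  unfolding peval_def sum_distrib_left
proof (rule sum.cong)
  fix m assume "m \<in> Poly_Mapping.keys p"
  then have "d = (\<Sum>i\<in>UNIV. Poly_Mapping.lookup m i)"
    using assms by (simp add: is_form_def)
  then show "Poly_Mapping.lookup p m * (\<Prod>i\<in>UNIV. (t *\<^sub>R x) $ i ^ Poly_Mapping.lookup m i) =
      t ^ d * (Poly_Mapping.lookup p m * (\<Prod>i\<in>UNIV. x $ i ^ Poly_Mapping.lookup m i))"
    by (simp add: power_mult_distrib prod.distrib power_sum)
qed simp

text \<open>
  Differentiate \<open>F (t x) = t\<^sup>k F x\<close> in \<open>t\<close> at \<open>t = 1\<close>. Vector values are allowed so that the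
  identity applies to gradients as well.
\<close>
lemma Euler_homogeneous:
  fixes F :: "'a::real_normed_vector \<Rightarrow> 'b::real_normed_vector"
  assumes F: "(F has_derivative F') (at x)"
    and hom: "\<And>t. t > 0 \<Longrightarrow> F (t *\<^sub>R x) = t ^ k *\<^sub>R F x"
  shows "F' x = real k *\<^sub>R F x"
proof -
  have "((\<lambda>t. F (t *\<^sub>R x)) has_derivative (\<lambda>h. F' (h *\<^sub>R x))) (at (1::real))"
    by (rule has_derivative_compose[of "\<lambda>t. t *\<^sub>R x" _ _ _ F]) (auto intro!: derivative_eq_intros F)
  moreover have "((\<lambda>t. t ^ k *\<^sub>R F x) has_derivative (\<lambda>h. (real k * h) *\<^sub>R F x)) (at (1::real))"
    by (auto intro!: derivative_eq_intros)
  then have "((\<lambda>t. F (t *\<^sub>R x)) has_derivative (\<lambda>h. (real k * h) *\<^sub>R F x)) (at (1::real))"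
    by (rule has_derivative_transform_within_open[where s = "{0<..}"]) (auto simp: hom)
  ultimately have "(\<lambda>h. F' (h *\<^sub>R x)) = (\<lambda>h. (real k * h) *\<^sub>R F x)"
    by (rule has_derivative_unique)
  from fun_cong[OF this, of 1] show ?thesis by simp
qed

text \<open>Here \<open>f (t x) = t\<^sup>k\<^sup>+\<^sup>1 f x\<close> is differentiated in \<open>x\<close> instead, for fixed \<open>t\<close>.\<close>
lemma gradient_homogeneous:
  fixes f :: "real^'n::finite \<Rightarrow> real"
  assumes f: "real_polynomial_function f"
    and hom: "\<And>t x. t > 0 \<Longrightarrow> f (t *\<^sub>R x) = t ^ Suc k * f x"
    and t: "t > 0"
  shows "gradient f (t *\<^sub>R x) = t ^ k *\<^sub>R gradient f x"
proof -
  have "((\<lambda>y. f (t *\<^sub>R y)) has_derivative (\<lambda>h. gradient f (t *\<^sub>R x) \<bullet> (t *\<^sub>R h))) (at x)"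
    by (rule has_derivative_compose[of "\<lambda>y. t *\<^sub>R y" _ _ _ f])
      (auto intro!: derivative_eq_intros has_derivative_gradient[OF f])
  moreover have "((\<lambda>y. f (t *\<^sub>R y)) has_derivative (\<lambda>h. t ^ Suc k * (gradient f x \<bullet> h))) (at x)"
    unfolding hom[OF t] by (rule has_derivative_mult_right has_derivative_gradient[OF f])+
  ultimately have "(\<lambda>h. gradient f (t *\<^sub>R x) \<bullet> (t *\<^sub>R h)) = (\<lambda>h. t ^ Suc k * (gradient f x \<bullet> h))"
    by (rule has_derivative_unique)
  then have "t * (gradient f (t *\<^sub>R x) \<bullet> h) = t * ((t ^ k *\<^sub>R gradient f x) \<bullet> h)" for h
    by (auto simp: fun_eq_iff)
  with t have "gradient f (t *\<^sub>R x) \<bullet> h = (t ^ k *\<^sub>R gradient f x) \<bullet> h" for h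
    by (metis mult_left_cancel less_irrefl)
  then show ?thesis using vector_eq_rdot by blast
qed

section \<open>Local minima of quadratic forms on the sphere\<close>

text \<open>
  Splitting off one variable lowers the total degree by one; doing it twice leaves the empty product.
  The form \<open>x i * x j\<close> makes the parallelogram law a matter of expanding.
\<close>
lemma degree2_monomial:
  fixes m :: "'n::finite \<Rightarrow> nat"
  assumes "sum m UNIV = 2"
  shows "\<exists>i j. \<forall>x::'n \<Rightarrow> real. (\<Prod>l\<in>UNIV. x l ^ m l) = x i * x j"
proof -
  have split: "\<exists>i m'. sum m' UNIV = k \<and> (\<forall>x::'n \<Rightarrow> real. (\<Prod>l\<in>UNIV. x l ^ m l) = x i * (\<Prod>l\<in>UNIV. x l ^ m' l))"
    if m: "sum m UNIV = Suc k" for k and m :: "'n \<Rightarrow> nat"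
  proof -
    obtain i where i: "m i > 0"
      using m by (metis Suc_neq_Zero gr0I sum.neutral)
    let ?m' = "m(i := m i - 1)"
    have "sum m UNIV = (\<Sum>l\<in>UNIV. ?m' l + (if l = i then 1 else 0))"
      using i by (intro sum.cong) auto
    then have "sum m UNIV = sum ?m' UNIV + 1"
      by (simp add: sum.distrib del: fun_upd_apply)
    moreover have "(\<Prod>l\<in>UNIV. x l ^ m l) = x i * (\<Prod>l\<in>UNIV. x l ^ ?m' l)" for x :: "'n \<Rightarrow> real"
    proof -
      have "(\<Prod>l\<in>UNIV. x l ^ m l) = (\<Prod>l\<in>UNIV. x l ^ ?m' l) * (\<Prod>l\<in>UNIV. if l = i then x l else 1)"
        unfolding prod.distrib[symmetric] using i
        by (intro prod.cong) (auto simp flip: power_Suc2)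
      then show ?thesis by simp
    qed
    ultimately show ?thesis using m by (intro exI[of _ i] exI[of _ ?m']) (simp del: fun_upd_apply)
  qed
  from split[of m 1] assms obtain i m' where "sum m' UNIV = 1"
    and 1: "\<And>x::'n \<Rightarrow> real. (\<Prod>l\<in>UNIV. x l ^ m l) = x i * (\<Prod>l\<in>UNIV. x l ^ m' l)"
    by (auto simp: numeral_2_eq_2)
  from split[of m' 0] this(1) obtain j m'' where "sum m'' UNIV = 0"
    and "\<And>x::'n \<Rightarrow> real. (\<Prod>l\<in>UNIV. x l ^ m' l) = x j * (\<Prod>l\<in>UNIV. x l ^ m'' l)"
    by auto
  with 1 show ?thesis by (intro exI[of _ i] exI[of _ j]) simp
qed

lemma quadratic_form_parallelogram:
  assumes "is_form 2 p"
  shows "peval p (x + y) + peval p (x - y) = 2 * peval p x + 2 * peval p y"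
  unfolding peval_def sum_distrib_left sum.distrib[symmetric]
proof (rule sum.cong)
  fix m assume "m \<in> Poly_Mapping.keys p"
  then have "(\<Sum>l\<in>UNIV. Poly_Mapping.lookup m l) = 2"
    using assms by (simp add: is_form_def)
  from degree2_monomial[OF this] obtain i j
    where *: "\<And>x::'a \<Rightarrow> real. (\<Prod>l\<in>UNIV. x l ^ Poly_Mapping.lookup m l) = x i * x j"
    by blast
  show "Poly_Mapping.lookup p m * (\<Prod>i\<in>UNIV. (x + y) $ i ^ Poly_Mapping.lookup m i) +
    Poly_Mapping.lookup p m * (\<Prod>i\<in>UNIV. (x - y) $ i ^ Poly_Mapping.lookup m i) =
    2 * (Poly_Mapping.lookup p m * (\<Prod>i\<in>UNIV. x $ i ^ Poly_Mapping.lookup m i)) +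
    2 * (Poly_Mapping.lookup p m * (\<Prod>i\<in>UNIV. y $ i ^ Poly_Mapping.lookup m i))"
    unfolding *[of "\<lambda>l. _ $ l"] by (simp add: algebra_simps)
qed simp

text \<open>
  By homogeneity, \<open>h z = f z - f x |z|\<^sup>2\<close> is nonnegative on a full neighbourhood of \<open>x\<close>, not only on
  the sphere. Since \<open>h\<close> satisfies the parallelogram law and \<open>h x = 0\<close>,
  \<open>2 s\<^sup>2 h y = h (x + s y) + h (x - s y) \<ge> 0\<close> for small \<open>s\<close>, for any \<open>y\<close> whatsoever.
\<close>
lemma local_minimizer_quadratic_form_global:
  fixes f :: "real^'n::finite \<Rightarrow> real"
  assumes par: "\<And>x y. f (x + y) + f (x - y) = 2 * f x + 2 * f y"
    and hom: "\<And>t x. f (t *\<^sub>R x) = t\<^sup>2 * f x"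
    and x: "local_minimizer f x" and y: "y \<in> sphere 0 1"
  shows "f x \<le> f y"
proof -
  obtain e where e: "e > 0" and min: "\<And>z. norm z = 1 \<Longrightarrow> norm (z - x) < e \<Longrightarrow> f x \<le> f z"
    and nx: "norm x = 1"
    using x by (auto simp: local_minimizer_def)
  have "((\<lambda>z. norm (z /\<^sub>R norm z - x)) \<longlongrightarrow> norm (x /\<^sub>R norm x - x)) (at x)"
    by (intro tendsto_intros) (use nx in auto)
  then have "\<forall>\<^sub>F z in at x. norm (z /\<^sub>R norm z - x) < e"
    using e nx by (intro order_tendstoD) auto
  moreover have "\<forall>\<^sub>F z in at x. z \<noteq> 0"
    using nx by (intro eventually_neq_at_within)
  ultimately have "\<forall>\<^sub>F z in at x. f x * (norm z)\<^sup>2 \<le> f z"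
  proof eventually_elim
    case (elim z)
    then have "f x \<le> f (z /\<^sub>R norm z)" by (intro min) auto
    then show ?case using elim by (simp add: hom field_simps)
  qed
  then obtain r where r: "r > 0"
    and near': "\<And>z. z \<noteq> x \<Longrightarrow> norm (z - x) < r \<Longrightarrow> f x * (norm z)\<^sup>2 \<le> f z"
    by (auto simp: eventually_at dist_norm)
  have near: "f x * (norm z)\<^sup>2 \<le> f z" if "norm (z - x) < r" for z
    using near'[of z] that nx by (cases "z = x") auto
  define s where "s = r / 2"
  have s: "s > 0" "s < r" using r by (auto simp: s_def)
  have "f x * ((norm (x + s *\<^sub>R y))\<^sup>2 + (norm (x - s *\<^sub>R y))\<^sup>2) \<le> f (x + s *\<^sub>R y) + f (x - s *\<^sub>R y)"
    using near[of "x + s *\<^sub>R y"] near[of "x - s *\<^sub>R y"] s y by (simp add: algebra_simps)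
  also have "\<dots> = 2 * f x + 2 * (s\<^sup>2 * f y)" by (simp add: par hom)
  also have "(norm (x + s *\<^sub>R y))\<^sup>2 + (norm (x - s *\<^sub>R y))\<^sup>2 = 2 + 2 * s\<^sup>2"
    using y nx unfolding power2_norm_eq_inner
    by (simp add: inner_simps inner_commute norm_eq_1 power2_eq_square)
  finally show ?thesis using s by (simp add: algebra_simps)
qed

lemma quadratic_form_unique_local_minimum:
  fixes f :: "real^'n::finite \<Rightarrow> real"
  assumes f: "continuous_on (sphere 0 1) f"
    and par: "\<And>x y. f (x + y) + f (x - y) = 2 * f x + 2 * f y"
    and hom: "\<And>t x. f (t *\<^sub>R x) = t\<^sup>2 * f x"
  shows "\<exists>!v. local_minimum f v" and "local_minimum f v \<Longrightarrow> global_minimum f v"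
proof -
  note global = local_minimizer_quadratic_form_global[OF par hom]
  have "sphere 0 1 \<noteq> ({} :: (real^'n) set)" by simp
  then obtain x where "x \<in> sphere 0 1" "\<And>y. y \<in> sphere 0 1 \<Longrightarrow> f x \<le> f y"
    using continuous_attains_inf[OF compact_sphere _ f] by metis
  then have "local_minimizer f x"
    unfolding local_minimizer_def by (auto intro!: exI[of _ 1])
  then have "local_minimum f (f x)" by (auto simp: local_minimum_def)
  moreover have "v = w" if "local_minimum f v" "local_minimum f w" for v w
  proof -
    obtain y where "local_minimizer f y" "f y = v"
      using \<open>local_minimum f v\<close> unfolding local_minimum_def by blast
    moreover obtain z where "local_minimizer f z" "f z = w"
      using \<open>local_minimum f w\<close> unfolding local_minimum_def by blast
    ultimately show ?thesis
      using global[of y z] global[of z y] by (auto simp: local_minimizer_def)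
  qed
  ultimately show "\<exists>!v. local_minimum f v" by blast
  show "global_minimum f v" if "local_minimum f v"
    using that global unfolding local_minimum_def global_minimum_def
    by (metis local_minimizer_def)
qed

section \<open>Optimality conditions for homogeneous polynomials\<close>

lemma homogeneous_FONC_multiplier:
  fixes f :: "real^'n::finite \<Rightarrow> real"
  assumes f: "real_polynomial_function f"
    and hom: "\<And>t x. t > 0 \<Longrightarrow> f (t *\<^sub>R x) = t ^ d * f x"
    and x: "FONC_with f x l"
  shows "2 * l = - (real d * f x)"
proof -
  have "gradient f x \<bullet> x = real d * f x"
    using Euler_homogeneous[OF has_derivative_gradient[OF f], of x d] hom by simp
  moreover have "gradient f x = - (2 * l) *\<^sub>R x" "x \<bullet> x = 1"
    using x by (simp_all add: FONC_with_def add_eq_0_iff2 norm_eq_1)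
  ultimately show ?thesis by simp
qed

lemma homogeneous_FONC_hessian_eigenvector:
  fixes f :: "real^'n::finite \<Rightarrow> real"
  assumes f: "real_polynomial_function f"
    and hom: "\<And>t x. t > 0 \<Longrightarrow> f (t *\<^sub>R x) = t ^ d * f x"
    and d: "d > 0" and x: "FONC_with f x l"
  shows "hessian f x *v x = (real d * (real d - 1) * f x) *\<^sub>R x"
proof -
  have "d = Suc (d - 1)" using d by simp
  then have "gradient f (t *\<^sub>R x) = t ^ (d - 1) *\<^sub>R gradient f x" if "t > 0" for t
    using gradient_homogeneous[OF f _ that, of "d - 1"] hom by metis
  then have "hessian f x *v x = real (d - 1) *\<^sub>R gradient f x"
    using Euler_homogeneous[OF has_derivative_hessian[OF f]] by metis
  moreover have "gradient f x = - (2 * l) *\<^sub>R x"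
    using x by (simp add: FONC_with_def add_eq_0_iff2)
  moreover have "- (2 * l) = real d * f x"
    using homogeneous_FONC_multiplier[OF f hom x] by simp
  ultimately have "hessian f x *v x = (real (d - 1) * (real d * f x)) *\<^sub>R x"
    by (metis scaleR_scaleR)
  then show ?thesis
    using d by (simp add: of_nat_diff mult_ac)
qed

text \<open>
  All that the optimality conditions need to know about the Hessian: its eigenvalues \<open>l\<close>, the index
  \<open>i\<^sub>0\<close> of the eigenvector \<open>x\<close>, and (SONC) as a condition on the other indices.
\<close>
lemma homogeneous_FONC_hessian_spectrum:
  fixes f :: "real^'n::finite \<Rightarrow> real"
  assumes f: "real_polynomial_function f"
    and hom: "\<And>t x. t > 0 \<Longrightarrow> f (t *\<^sub>R x) = t ^ d * f x"
    and d: "d > 0" and x: "FONC f x"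
  obtains l i\<^sub>0 where "l i\<^sub>0 = real d * (real d - 1) * f x"
    and "SONC f x \<longleftrightarrow> (\<forall>i. i \<noteq> i\<^sub>0 \<longrightarrow> real d * f x \<le> l i)"
    and "\<And>k c. 1 \<le> k \<Longrightarrow> k \<le> CARD('n) \<Longrightarrow>
           c \<le> eigval k (hessian f x) \<longleftrightarrow> card {i :: 'n. l i < c} < k"
proof -
  obtain \<mu> where \<mu>: "FONC_with f x \<mu>" using x by (auto simp: FONC_def)
  then have "norm x = 1" by (simp add: FONC_with_def)
  with symmetric_matrix_diagonalization_extending[OF transpose_hessian[OF f]
      this homogeneous_FONC_hessian_eigenvector[OF f hom d \<mu>]]
  obtain P l i\<^sub>0 where P: "orthogonal_matrix P"
    and H: "hessian f x = transpose P ** diagonal_matrix l ** P"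
    and i0: "P $ i\<^sub>0 = x" "l i\<^sub>0 = real d * (real d - 1) * f x"
    by blast
  have "SONC f x \<longleftrightarrow> (\<forall>u\<in>unit_perp x. real d * f x \<le> u \<bullet> (hessian f x *v u))"
    using \<mu> homogeneous_FONC_multiplier[OF f hom] unfolding SONC_def by fastforce
  also have "\<dots> \<longleftrightarrow> (\<forall>i. i \<noteq> i\<^sub>0 \<longrightarrow> real d * f x \<le> l i)"
    using quadratic_form_ge_on_unit_perp_iff[OF P, of i\<^sub>0 "real d * f x" l] by (simp add: H i0)
  finally show thesis
    using that[of l i\<^sub>0] i0(2) eigval_ge_iff[OF P H] by blast
qed

lemma card_Collect_less_1_iff: "card {i :: 'n::finite. Q i} < 1 \<longleftrightarrow> (\<forall>i. \<not> Q i)"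
  by (auto simp: card_eq_0_iff)

text \<open>
  The hypothesis \<open>ge\<close> makes the eigenvalue \<open>d (d - 1) f x\<close> at \<open>x\<close> at least \<open>d f x\<close>, so the
  index left out by (SONC) satisfies the same bound as the others.
\<close>
lemma homogeneous_SONC_iff_eigval_1:
  fixes f :: "real^'n::finite \<Rightarrow> real"
  assumes f: "real_polynomial_function f"
    and hom: "\<And>t x. t > 0 \<Longrightarrow> f (t *\<^sub>R x) = t ^ d * f x"
    and d: "d > 0" and x: "FONC f x" and ge: "d = 2 \<or> d > 2 \<and> f x \<ge> 0"
  shows "SONC f x \<longleftrightarrow> eigval 1 (hessian f x) \<ge> real d * f x"
proof -
  obtain l i\<^sub>0 where l: "l i\<^sub>0 = real d * (real d - 1) * f x"
    and sonc: "SONC f x \<longleftrightarrow> (\<forall>i. i \<noteq> i\<^sub>0 \<longrightarrow> real d * f x \<le> l i)"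
    and eig: "\<And>k c. 1 \<le> k \<Longrightarrow> k \<le> CARD('n) \<Longrightarrow>
           c \<le> eigval k (hessian f x) \<longleftrightarrow> card {i :: 'n. l i < c} < k"
    using homogeneous_FONC_hessian_spectrum[OF f hom d x] by blast
  have "real d * f x * 1 \<le> real d * f x * (real d - 1)"
  proof (cases "d = 2")
    case False
    then show ?thesis using ge by (intro mult_left_mono) auto
  qed simp
  then have "real d * f x \<le> l i\<^sub>0" by (simp add: l mult_ac)
  then have "SONC f x \<longleftrightarrow> (\<forall>i. \<not> l i < real d * f x)"
    unfolding sonc not_less by metis
  then show ?thesis
    using eig[of 1 "real d * f x"] card_Collect_less_1_iff[of "\<lambda>i. l i < real d * f x"] by simp
qed

text \<open>
  Now \<open>d (d - 1) f x < d f x\<close>, so the index of \<open>x\<close> always violates the bound, and (SONC) says that it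
  is the only one to do so. In dimension one no unit vector is orthogonal to
  \<open>x\<close>, (SONC) follows from (FONC), and there is no second eigenvalue to bound.
\<close>
lemma homogeneous_SONC_negative:
  fixes f :: "real^'n::finite \<Rightarrow> real"
  assumes f: "real_polynomial_function f"
    and hom: "\<And>t x. t > 0 \<Longrightarrow> f (t *\<^sub>R x) = t ^ d * f x"
    and d: "d > 2" and x: "FONC f x" and neg: "f x < 0"
  shows "SONC f x \<longleftrightarrow> (CARD('n) \<ge> 2 \<longrightarrow> eigval 2 (hessian f x) \<ge> real d * f x)"
    and "SONC f x \<Longrightarrow> eigval 1 (hessian f x) = real d * (real d - 1) * f x"
proof -
  have "d > 0" using d by simp
  then obtain l i\<^sub>0 where l: "l i\<^sub>0 = real d * (real d - 1) * f x"
    and sonc: "SONC f x \<longleftrightarrow> (\<forall>i. i \<noteq> i\<^sub>0 \<longrightarrow> real d * f x \<le> l i)"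
    and eig: "\<And>k c. 1 \<le> k \<Longrightarrow> k \<le> CARD('n) \<Longrightarrow>
           c \<le> eigval k (hessian f x) \<longleftrightarrow> card {i :: 'n. l i < c} < k"
    using homogeneous_FONC_hessian_spectrum[OF f hom _ x] by blast
  have "real d * f x * (real d - 1) < real d * f x * 1"
    using d neg by (intro mult_strict_left_mono_neg) (auto simp: mult_pos_neg)
  then have less: "l i\<^sub>0 < real d * f x" by (simp add: l mult_ac)
  let ?L = "{i. l i < real d * f x}"
  have "card ?L < 2 \<longleftrightarrow> ?L = {i\<^sub>0}"
  proof
    assume "card ?L < 2"
    then have "card ?L \<le> card {i\<^sub>0}" by simp
    then show "?L = {i\<^sub>0}"
      using less by (intro card_seteq[symmetric]) auto
  qed simp
  also have "\<dots> \<longleftrightarrow> SONC f x" using less by (auto simp: sonc not_less[symmetric])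
  finally have card: "card ?L < 2 \<longleftrightarrow> SONC f x" .
  show "SONC f x \<longleftrightarrow> (CARD('n) \<ge> 2 \<longrightarrow> eigval 2 (hessian f x) \<ge> real d * f x)"
  proof (cases "CARD('n) \<ge> 2")
    case True
    then show ?thesis using eig[of 2] card by simp
  next
    case False
    moreover have "card ?L \<le> CARD('n)" by (intro card_mono) auto
    ultimately show ?thesis using card by simp
  qed
  assume "SONC f x"
  then have "l i\<^sub>0 \<le> l i" for i
    using less sonc by (cases "i = i\<^sub>0") (auto intro: order.trans less_imp_le)
  then have "c \<le> eigval 1 (hessian f x) \<longleftrightarrow> c \<le> l i\<^sub>0" for c
    using eig[of 1 c] card_Collect_less_1_iff[of "\<lambda>i. l i < c"]
    by (auto simp: not_less intro: order.trans)
  from this[of "l i\<^sub>0"] this[of "eigval 1 (hessian f x)"]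
  show "eigval 1 (hessian f x) = real d * (real d - 1) * f x" by (simp add: l)
qed

theorem corollary2p4:
  fixes p :: "'n::finite real_mpoly" and d :: nat and f :: "real^'n \<Rightarrow> real"
  assumes form: "is_form d p"
    and f: "f = peval p"
  shows
    "(d > 2 \<longrightarrow>
       (\<forall>x\<in>sphere 0 1. FONC f x \<longrightarrow>
          (SONC f x \<longleftrightarrow>
             (f x \<ge> 0 \<longrightarrow> eigval 1 (hessian f x) \<ge> real d * f x) \<and>
             (f x < 0 \<and> CARD('n) \<ge> 2 \<longrightarrow> eigval 2 (hessian f x) \<ge> real d * f x)) \<and>
          (SONC f x \<and> f x < 0 \<longrightarrow>
             eigval 1 (hessian f x) = real d * (real d - 1) * f x))) \<and>
     (d = 2 \<longrightarrow>
       (\<forall>x\<in>sphere 0 1. FONC f x \<longrightarrow>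
          (SONC f x \<longleftrightarrow> eigval 1 (hessian f x) \<ge> real d * f x)) \<and>
       (\<exists>!v. local_minimum f v) \<and>
       (\<forall>v. local_minimum f v \<longrightarrow> global_minimum f v))"
proof (intro conjI impI ballI)
  have poly: "real_polynomial_function f"
    by (simp add: f real_polynomial_function_peval)
  have hom: "f (t *\<^sub>R x) = t ^ d * f x" for t x
    by (simp add: f peval_homogeneous[OF form])
  {
    fix x assume d: "d > 2" and x: "FONC f x"
    show "SONC f x \<longleftrightarrow>
        (f x \<ge> 0 \<longrightarrow> eigval 1 (hessian f x) \<ge> real d * f x) \<and>
        (f x < 0 \<and> CARD('n) \<ge> 2 \<longrightarrow> eigval 2 (hessian f x) \<ge> real d * f x)"
    proof (cases "f x \<ge> 0")
      case True
      with d homogeneous_SONC_iff_eigval_1[OF poly hom _ x] show ?thesis by simp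
    next
      case False
      with homogeneous_SONC_negative(1)[OF poly hom d x] show ?thesis by simp
    qed
    show "eigval 1 (hessian f x) = real d * (real d - 1) * f x" if "SONC f x \<and> f x < 0"
      using homogeneous_SONC_negative(2)[OF poly hom d x] that by blast
  }
  assume d: "d = 2"
  show "SONC f x \<longleftrightarrow> eigval 1 (hessian f x) \<ge> real d * f x" if "FONC f x" for x
    using homogeneous_SONC_iff_eigval_1[OF poly hom _ that] d by simp
  have cont: "continuous_on (sphere 0 1) f"
    using has_derivative_gradient[OF poly] by (meson has_derivative_continuous_on has_derivative_at_withinI)
  have par: "f (x + y) + f (x - y) = 2 * f x + 2 * f y" for x y
    using quadratic_form_parallelogram form by (simp add: f d)
  have hom2: "f (t *\<^sub>R x) = t\<^sup>2 * f x" for t x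
    using hom d by simp
  show "\<exists>!v. local_minimum f v"
    by (rule quadratic_form_unique_local_minimum[OF cont par hom2])
  show "\<forall>v. local_minimum f v \<longrightarrow> global_minimum f v"
    using quadratic_form_unique_local_minimum(2)[OF cont par hom2] by blast
qed

end
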